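(* Let $I=[a,b]\subset\mathbb{R}$, let $m$ be a nonnegative integer and let $P:I\to\mathbb{R}$ be an integrable function. Then the inequality $$\int_a^b f(y)P(y)\,dy\ge 0$$ holds for all $(m+1)$-$\nabla$-convex functions $f\in C^{(m+1)}(I)$ if and only if $$\int_a^b P(y)\frac{(b-y)^i}{i!}\,dy=0\quad\text{for all } i\in\{0,1,\ldots,m\}$$ and $$\int_a^s P(y)\frac{(s-y)^m}{m!}\,dy\ge 0\quad\text{for all } s\in[a,b].$$
   Context: Here $a<b$ and $(\cdot)^0=1$. For distinct points, the divided difference is defined recursively by $[y_j;f]=f(y_j)$ and $[y_i,\ldots,y_{i+r};f]=\dfrac{[y_{i+1},\ldots,y_{i+r};f]-[y_i,\ldots,y_{i+r-1};f]}{y_{i+r}-y_i}$. A function $f:I\to\mathbb{R}$ is $r$-$\nabla$-convex ($\nabla$-convex of order $r$) if $(-1)^r[y_i,\ldots,y_{i+r};f]\ge 0$ for all choices of $r+1$ distinct points $y_i,\ldots,y_{i+r}\in I$. If $f^{(r)}$ exists, this is equivalent to $(-1)^r f^{(r)}\ge 0$ on $I$. $C^{(m+1)}(I)$ denotes the functions with continuous derivatives up to order $m+1$ on $I$. *)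

theory Defs
  imports "HOL-Analysis.Analysis"
begin

(* divided_difference f y i r is [y_i, ..., y_{i+r}; f]; it is meaningful when the
   nodes y_i, ..., y_{i+r} are pairwise distinct. *)
fun divided_difference :: "(real \<Rightarrow> real) \<Rightarrow> (nat \<Rightarrow> real) \<Rightarrow> nat \<Rightarrow> nat \<Rightarrow> real" where
  "divided_difference f y i 0 = f (y i)"
| "divided_difference f y i (Suc r) =
     (divided_difference f y (Suc i) r - divided_difference f y i r) / (y (i + Suc r) - y i)"

definition nabla_convex_on :: "nat \<Rightarrow> real set \<Rightarrow> (real \<Rightarrow> real) \<Rightarrow> bool" where
  "nabla_convex_on r I f \<longleftrightarrow>
     (\<forall>y i. inj_on y {i..i + r} \<and> y ` {i..i + r} \<subseteq> I
        \<longrightarrow> (- 1) ^ r * divided_difference f y i r \<ge> 0)"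

(* Derivatives are taken relative to I, hence are one-sided at the endpoints of a
   closed interval; g j is the j-th derivative of f on I. *)
definition C_k_on :: "nat \<Rightarrow> real set \<Rightarrow> (real \<Rightarrow> real) \<Rightarrow> bool" where
  "C_k_on k I f \<longleftrightarrow>
     (\<exists>g :: nat \<Rightarrow> real \<Rightarrow> real. g 0 = f
        \<and> (\<forall>j<k. \<forall>x\<in>I. (g j has_real_derivative g (Suc j) x) (at x within I))
        \<and> (\<forall>j\<le>k. continuous_on I (g j)))"

end

(* Expanding f at the right endpoint b with integral remainder and exchanging the order of
   integration gives
     int_a^b f P = sum_{i<=m} (-1)^i f^(i)(b) mu_i + int_a^b (-1)^(m+1) f^(m+1)(s) Q(s) ds,
   where mu_i is the integral of P(y) (b-y)^i / i! over [a,b] and Q(s) that of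
   P(y) (s-y)^m / m! over [a,s].  By the mean value theorem for divided differences,
   nabla-convexity of order m+1 means that the factor (-1)^(m+1) f^(m+1) is nonnegative, which
   gives sufficiency.  Conversely, f and -f are both nabla-convex for f = (b-y)^i, so mu_i = 0;
   and since (-1)^(m+1) f^(m+1) may be any nonnegative continuous function, in particular a bump
   on an interval where the continuous function Q is negative, Q cannot take negative values. *)

theory Submission
  imports Defs
begin

section \<open>Divided differences and derivatives\<close>

text \<open>Replaces the recursion by a leading coefficient, which differentiation can reach:
  \<open>coeff p r\<close> is, up to \<open>fact r\<close>, the r-th derivative of
  \<open>p\<close>.\<close>

lemma divided_difference_interpolation:
  assumes "inj_on y {i..i + r}"
  shows "\<exists>p :: real poly. degree p \<le> r \<and> coeff p r = divided_difference f y i r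
           \<and> (\<forall>j\<in>{i..i + r}. poly p (y j) = f (y j))"
  using assms
proof (induction r arbitrary: i)
  case 0
  show ?case by (rule exI[of _ "[:f (y i):]"]) simp
next
  case (Suc r)
  have "inj_on y {i..i + r}" and "inj_on y {Suc i..Suc i + r}"
    using Suc.prems by (auto intro: inj_on_subset)
  then obtain p q where p: "degree p \<le> r" "coeff p r = divided_difference f y i r"
      "\<And>j. j \<in> {i..i + r} \<Longrightarrow> poly p (y j) = f (y j)"
    and q: "degree q \<le> r" "coeff q r = divided_difference f y (Suc i) r"
      "\<And>j. j \<in> {Suc i..Suc i + r} \<Longrightarrow> poly q (y j) = f (y j)"
    using Suc.IH[of i] Suc.IH[of "Suc i"] by metis
  define d where "d = y (i + Suc r) - y i"
  have d: "d \<noteq> 0"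
    using inj_onD[OF Suc.prems, of "i + Suc r" i] by (auto simp: d_def)
  \<comment> \<open>Aitken-Neville step: \<open>p\<close> interpolates at all nodes but the last,
    \<open>q\<close> at all but the first. Each linear factor removes one interpolant at the node
    that it misses, and comparing leading coefficients gives the recursion of
    \<open>divided_difference\<close>.\<close>
  define u where "u = smult (inverse d) ([:- y i, 1:] * q - [:- y (i + Suc r), 1:] * p)"
  have "degree u \<le> Suc r"
    unfolding u_def using p(1) q(1)
    by (intro order.trans[OF degree_smult_le] degree_diff_le order.trans[OF degree_mult_le])
       (auto simp: degree_pCons_eq_if)
  moreover have "coeff u (Suc r) = divided_difference f y i (Suc r)"
    using p(1,2) q(1,2) by (simp add: u_def d_def coeff_eq_0 divide_inverse)
  moreover have "poly u (y j) = f (y j)" if j: "j \<in> {i..i + Suc r}" for j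
  proof -
    have eq: "poly u (y j) = ((y j - y i) * poly q (y j) - (y j - y (i + Suc r)) * poly p (y j)) / d"
      by (simp add: u_def field_simps)
    consider "j = i" | "j = i + Suc r" | "j \<in> {i..i + r}" "j \<in> {Suc i..Suc i + r}"
      using j by fastforce
    then show ?thesis
    proof cases
      case 1
      then have "poly u (y j) = (d * f (y j)) / d"
        using eq p(3)[of i] by (simp add: d_def algebra_simps)
      then show ?thesis using d by simp
    next
      case 2
      then show ?thesis using eq d q(3)[of j] by (simp add: d_def divide_eq_eq)
    next
      case 3
      then have "poly u (y j) = (d * f (y j)) / d"
        using eq p(3) q(3) by (simp add: d_def algebra_simps)
      then show ?thesis using d by simp
    qed
  qed
  ultimately show ?case by blast
qed

text \<open>Induction on the largest zero \<open>M\<close>: the zeros of \<open>f'\<close> found for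
  the other points lie strictly left of the second largest zero \<open>c\<close>, and Rolle between
  \<open>c\<close> and \<open>M\<close> adds one strictly right of \<open>c\<close>. The
  localisation between \<open>Min Z\<close> and \<open>Max Z\<close> is what keeps the new zero
  distinct.\<close>

lemma Rolle_zeros:
  fixes f f' :: "real \<Rightarrow> real"
  assumes "card Z = Suc n" and "Z \<subseteq> {a..b}" and "\<And>x. x \<in> Z \<Longrightarrow> f x = 0"
    and deriv: "\<And>x. x \<in> {a..b} \<Longrightarrow> (f has_real_derivative f' x) (at x within {a..b})"
  shows "\<exists>Z'. card Z' = n \<and> finite Z' \<and> Z' \<subseteq> {Min Z<..<Max Z} \<and> (\<forall>x\<in>Z'. f' x = 0)"
  using assms(1-3)
proof (induction n arbitrary: Z)
  case 0
  then show ?case by (intro exI[of _ "{}"]) simp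
next
  case (Suc n)
  have fin: "finite Z" using Suc.prems(1) by (simp add: card_ge_0_finite)
  define M where "M = Max Z"
  define Y where "Y = Z - {M}"
  have ne: "Z \<noteq> {}" using Suc.prems(1) by auto
  have MZ: "M \<in> Z" using fin ne by (simp add: M_def)
  have cY: "card Y = Suc n" using MZ fin Suc.prems(1) by (simp add: Y_def)
  have finY: "finite Y" using fin by (simp add: Y_def)
  have neY: "Y \<noteq> {}" using cY by auto
  define c where "c = Max Y"
  have cY': "c \<in> Y" using finY neY by (simp add: c_def)
  then have cZ: "c \<in> Z" and "c \<noteq> M" by (auto simp: Y_def)
  moreover have "c \<le> M" using cZ fin by (simp add: M_def)
  ultimately have cM: "c < M" by simp
  obtain X where X: "card X = n" "finite X" "X \<subseteq> {Min Y<..<c}" "\<forall>x\<in>X. f' x = 0"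
    using Suc.IH[OF cY] Suc.prems(2,3) by (auto simp: Y_def c_def)
  have sub: "{c..M} \<subseteq> {a..b}" using cZ MZ Suc.prems(2) by auto
  have der: "(f has_real_derivative f' x) (at x)" if "c < x" "x < M" for x
  proof -
    have "a < x" "x < b" using that sub cM by auto
    then show ?thesis using deriv[of x] by (simp add: at_within_Icc_at)
  qed
  have "continuous_on {c..M} f"
    using sub deriv by (meson DERIV_continuous_on continuous_on_subset)
  then obtain z where z: "c < z" "z < M" "DERIV f z :> 0"
    using Rolle[of c M f] cM Suc.prems(3)[OF cZ] Suc.prems(3)[OF MZ] der
    by (metis real_differentiable_def)
  have fz: "f' z = 0" using der z DERIV_unique by blast
  have "Min Z \<le> Min Y" using fin neY by (intro Min_antimono) (auto simp: Y_def)
  moreover have "Min Y \<le> c" using finY cY' by simp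
  ultimately have "insert z X \<subseteq> {Min Z<..<Max Z}"
    using X(3) z cM by (fastforce simp: M_def)
  moreover have "card (insert z X) = Suc n" using X z by (subst card_insert_disjoint) auto
  ultimately show ?case using X fz by (intro exI[of _ "insert z X"]) auto
qed

text \<open>Each derivative costs one zero, so r+1 zeros of \<open>g 0\<close> leave one for
  \<open>g r\<close>. The induction shifts the whole family \<open>g\<close> by one index.\<close>

lemma Rolle_iterated:
  fixes g :: "nat \<Rightarrow> real \<Rightarrow> real"
  assumes "card Z = Suc r" and "Z \<subseteq> {a..b}" and "\<And>x. x \<in> Z \<Longrightarrow> g 0 x = 0"
    and "\<And>j x. j < r \<Longrightarrow> x \<in> {a..b} \<Longrightarrow> (g j has_real_derivative g (Suc j) x) (at x within {a..b})"
  shows "\<exists>\<xi>\<in>{a..b}. g r \<xi> = 0"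
  using assms
proof (induction r arbitrary: g Z)
  case 0
  then obtain z where "Z = {z}" by (auto simp: card_1_singleton_iff)
  then show ?case using 0 by auto
next
  case (Suc r)
  have fin: "finite Z" "Z \<noteq> {}" using Suc.prems(1) by (auto simp: card_ge_0_finite)
  obtain Z' where Z': "card Z' = Suc r" "Z' \<subseteq> {Min Z<..<Max Z}" "\<And>x. x \<in> Z' \<Longrightarrow> g (Suc 0) x = 0"
    using Rolle_zeros[OF Suc.prems(1-3) Suc.prems(4)[of 0]] by auto
  have "Min Z \<in> {a..b}" "Max Z \<in> {a..b}"
    using Min_in[OF fin] Max_in[OF fin] Suc.prems(2) by blast+
  then have "Z' \<subseteq> {a..b}" using Z'(2) by fastforce
  then show ?case
    using Suc.IH[of Z' "\<lambda>j. g (Suc j)"] Z' Suc.prems(4) by auto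
qed

lemma coeff_0_pderiv_funpow:
  "coeff ((pderiv ^^ n) p) 0 = fact n * coeff (p :: real poly) n"
proof -
  \<comment> \<open>The induction has to range over all \<open>k\<close>, since each derivative
    moves coefficient k+1 down to k.\<close>
  have "fact k * coeff ((pderiv ^^ n) p) k = fact (n + k) * coeff p (n + k)" for k
  proof (induction n arbitrary: k)
    case (Suc n)
    have "fact k * coeff ((pderiv ^^ Suc n) p) k = fact (Suc k) * coeff ((pderiv ^^ n) p) (Suc k)"
      by (simp add: coeff_pderiv del: of_nat_Suc)
    also have "\<dots> = fact (n + Suc k) * coeff p (n + Suc k)" by (rule Suc.IH)
    finally show ?case by simp
  qed simp
  from this[of 0] show ?thesis by simp
qed

lemma degree_pderiv_funpow: "degree ((pderiv ^^ n) (p :: real poly)) = degree p - n"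
  by (induction n) (auto simp: degree_pderiv)

text \<open>The difference of \<open>g 0\<close> and its interpolating polynomial vanishes at r+1
  nodes, so its r-th derivative has a zero. The r-th derivative of the polynomial is constant,
  namely r! times the coefficient of degree r.\<close>

lemma divided_difference_mean_value:
  fixes g :: "nat \<Rightarrow> real \<Rightarrow> real"
  assumes inj: "inj_on y {i..i + r}" and sub: "y ` {i..i + r} \<subseteq> {a..b}"
    and deriv: "\<And>j x. j < r \<Longrightarrow> x \<in> {a..b} \<Longrightarrow>
      (g j has_real_derivative g (Suc j) x) (at x within {a..b})"
  shows "\<exists>\<xi>\<in>{a..b}. fact r * divided_difference (g 0) y i r = g r \<xi>"
proof -
  obtain p where p: "degree p \<le> r" "coeff p r = divided_difference (g 0) y i r"
      "\<forall>j\<in>{i..i + r}. poly p (y j) = g 0 (y j)"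
    using divided_difference_interpolation[OF inj] by blast
  define h where "h j x = g j x - poly ((pderiv ^^ j) p) x" for j x
  have "\<exists>\<xi>\<in>{a..b}. h r \<xi> = 0"
  proof (rule Rolle_iterated[of "y ` {i..i + r}"])
    show "card (y ` {i..i + r}) = Suc r" using inj by (simp add: card_image)
    show "(h j has_real_derivative h (Suc j) x) (at x within {a..b})" if "j < r" "x \<in> {a..b}" for j x
      unfolding h_def using deriv[OF that]
      by (auto intro!: derivative_eq_intros DERIV_subset[OF poly_DERIV])
  qed (use sub p(3) in \<open>auto simp: h_def\<close>)
  moreover have "poly ((pderiv ^^ r) p) x = fact r * divided_difference (g 0) y i r" for x
  proof -
    have "degree ((pderiv ^^ r) p) = 0" using p(1) by (simp add: degree_pderiv_funpow)
    then obtain c where "(pderiv ^^ r) p = [:c:]" by (meson degree_eq_zeroE)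
    then show ?thesis using coeff_0_pderiv_funpow[of r p] p(2) by simp
  qed
  ultimately show ?thesis by (metis (no_types, lifting) h_def eq_iff_diff_eq_0)
qed

section \<open>Nabla-convexity as a sign condition on the derivative\<close>

lemma nabla_convex_on_if_deriv_nonneg:
  fixes g :: "nat \<Rightarrow> real \<Rightarrow> real"
  assumes "\<And>j x. j < r \<Longrightarrow> x \<in> {a..b} \<Longrightarrow>
      (g j has_real_derivative g (Suc j) x) (at x within {a..b})"
    and nonneg: "\<And>x. x \<in> {a..b} \<Longrightarrow> (- 1) ^ r * g r x \<ge> 0"
  shows "nabla_convex_on r {a..b} (g 0)"
  unfolding nabla_convex_on_def
proof (intro allI impI, elim conjE)
  fix y i assume "inj_on y {i..i + r}" "y ` {i..i + r} \<subseteq> {a..b}"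
  then obtain \<xi> where "\<xi> \<in> {a..b}" "fact r * divided_difference (g 0) y i r = g r \<xi>"
    using divided_difference_mean_value[of y i r a b g] assms(1) by blast
  then have "0 \<le> fact r * ((- 1) ^ r * divided_difference (g 0) y i r)"
    using nonneg[of \<xi>] by (metis mult.left_commute)
  then show "0 \<le> (- 1) ^ r * divided_difference (g 0) y i r"
    by (intro mult_left_le_imp_le[of "fact r" 0]) (simp_all only: mult_zero_right fact_gt_zero)
qed

lemma continuous_on_neg_subinterval:
  fixes f :: "real \<Rightarrow> real"
  assumes "a < b" and "continuous_on {a..b} f" and x: "x \<in> {a..b}" and "f x < 0"
  shows "\<exists>c d. c < d \<and> {c..d} \<subseteq> {a..b} \<and> (\<forall>t\<in>{c..d}. f t < 0)"
proof -
  obtain \<delta> where \<delta>: "\<delta> > 0" "\<forall>t\<in>{a..b}. dist t x < \<delta> \<longrightarrow> dist (f t) (f x) < - f x"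
    using assms(2-4) unfolding continuous_on_iff by (metis neg_0_less_iff_less)
  have neg: "f t < 0" if "t \<in> {a..b}" "dist t x < \<delta>" for t
    using \<delta>(2) that by (fastforce simp: dist_real_def abs_less_iff)
  \<comment> \<open>The interval is clipped because \<open>x\<close> may be an endpoint; the half of
    \<delta> keeps the closed interval inside the open \<delta>-neighbourhood.\<close>
  define c where "c = max a (x - \<delta> / 2)"
  define d where "d = min b (x + \<delta> / 2)"
  have "c < d" using \<open>a < b\<close> x \<delta>(1) by (auto simp: c_def d_def)
  moreover have sub: "{c..d} \<subseteq> {a..b}" by (auto simp: c_def d_def)
  moreover have "f t < 0" if "t \<in> {c..d}" for t
  proof (rule neg)
    show "dist t x < \<delta>" using that \<delta>(1) by (auto simp: c_def d_def dist_real_def)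
  qed (use that sub in blast)
  ultimately show ?thesis by blast
qed

text \<open>A wrong sign at one point persists on a subinterval by continuity. With all nodes chosen
  there, the mean value point lies there too, and the divided difference inherits the wrong
  sign.\<close>

lemma deriv_nonneg_if_nabla_convex_on:
  fixes g :: "nat \<Rightarrow> real \<Rightarrow> real"
  assumes "a < b" and conv: "nabla_convex_on r {a..b} (g 0)"
    and deriv: "\<And>j x. j < r \<Longrightarrow> x \<in> {a..b} \<Longrightarrow>
      (g j has_real_derivative g (Suc j) x) (at x within {a..b})"
    and cont: "continuous_on {a..b} (g r)" and x: "x \<in> {a..b}"
  shows "(- 1) ^ r * g r x \<ge> 0"
proof (rule ccontr)
  assume neg: "\<not> (- 1) ^ r * g r x \<ge> 0"
  have "continuous_on {a..b} (\<lambda>x. (- 1) ^ r * g r x)" using cont by (intro continuous_intros)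
  then obtain c d where cd: "c < d" and sub: "{c..d} \<subseteq> {a..b}"
    and small: "\<And>t. t \<in> {c..d} \<Longrightarrow> (- 1) ^ r * g r t < 0"
    using continuous_on_neg_subinterval[OF \<open>a < b\<close> _ x] neg
    by (metis (no_types, lifting) not_le)
  \<comment> \<open>Equidistant nodes in [c, d); dividing by r+1 instead of r also covers r =
    0.\<close>
  define y where "y j = c + (d - c) * real j / real (Suc r)" for j
  have inj: "inj_on y {0..0 + r}" using cd by (auto simp: inj_on_def y_def)
  have yim: "y ` {0..0 + r} \<subseteq> {c..d}"
  proof safe
    fix j assume "j \<in> {0..0 + r}"
    then have "(d - c) * (real j / real (Suc r)) \<le> (d - c) * 1"
      using cd by (intro mult_left_mono) auto
    then show "y j \<in> {c..d}" using cd by (simp add: y_def)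
  qed
  obtain \<xi> where \<xi>: "\<xi> \<in> {c..d}" "fact r * divided_difference (g 0) y 0 r = g r \<xi>"
    using divided_difference_mean_value[OF inj yim, of g] deriv sub
    by (meson DERIV_subset subsetD)
  have "0 \<le> (- 1) ^ r * divided_difference (g 0) y 0 r"
    using conv inj yim sub unfolding nabla_convex_on_def by blast
  then have "0 \<le> fact r * ((- 1) ^ r * divided_difference (g 0) y 0 r)" by simp
  then have "0 \<le> (- 1) ^ r * g r \<xi>" using \<xi>(2) by (metis mult.left_commute)
  then show False using small[OF \<xi>(1)] by simp
qed

section \<open>Taylor expansion at the right endpoint\<close>

lemma Taylor_remainder_has_integral_right:
  fixes g :: "nat \<Rightarrow> real \<Rightarrow> real"
  assumes "y \<le> b"
    and deriv: "\<And>j x. j \<le> m \<Longrightarrow> x \<in> {y..b} \<Longrightarrow>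
      (g j has_real_derivative g (Suc j) x) (at x within {y..b})"
  shows "((\<lambda>s. g (Suc m) s * ((s - y) ^ m / fact m)) has_integral
     (- 1) ^ m * ((\<Sum>i\<le>m. (- 1) ^ i * g i b * ((b - y) ^ i / fact i)) - g 0 y)) {y..b}"
proof -
  \<comment> \<open>The Taylor polynomial of \<open>g 0\<close> centred at \<open>s\<close> and
    evaluated at \<open>y\<close>, seen as a function of the centre. Its derivative telescopes to a
    single term, so it is a primitive of the remainder integrand up to sign.\<close>
  define F where "F n s = (\<Sum>i\<le>n. (- 1) ^ i * g i s * ((s - y) ^ i / fact i))" for n s
  have F: "(F n has_real_derivative (- 1) ^ n * g (Suc n) s * ((s - y) ^ n / fact n)) (at s within {y..b})"
    if "n \<le> m" "s \<in> {y..b}" for n s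
    using that
  proof (induction n)
    case 0
    then show ?case using deriv[of 0 s] by (simp add: F_def[abs_def])
  next
    case (Suc n)
    have "((\<lambda>s. (s - y) ^ Suc n / fact (Suc n)) has_real_derivative (s - y) ^ n / fact n) (at s within {y..b})"
    proof (rule DERIV_cong)
      show "((\<lambda>s. (s - y) ^ Suc n / fact (Suc n)) has_real_derivative
          (1 + of_nat n) * (1 * (s - y) ^ n) / fact (Suc n)) (at s within {y..b})"
        by (intro DERIV_cdivide DERIV_power_Suc) (auto intro!: derivative_eq_intros)
      have "1 + real n \<noteq> 0" by linarith
      then show "(1 + of_nat n) * (1 * (s - y) ^ n) / fact (Suc n) = (s - y) ^ n / fact n"
        by (simp only: fact_Suc of_nat_Suc mult_1 mult_divide_mult_cancel_left not_False_eq_True)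
    qed
    then have step: "((\<lambda>s. F n s + (- 1) ^ Suc n * g (Suc n) s * ((s - y) ^ Suc n / fact (Suc n)))
       has_real_derivative (- 1) ^ n * g (Suc n) s * ((s - y) ^ n / fact n) +
        ((- 1) ^ Suc n * g (Suc (Suc n)) s * ((s - y) ^ Suc n / fact (Suc n))
         + (s - y) ^ n / fact n * ((- 1) ^ Suc n * g (Suc n) s))) (at s within {y..b})"
      using Suc by (intro DERIV_add DERIV_mult DERIV_cmult deriv) auto
    have F_Suc: "F (Suc n) = (\<lambda>s. F n s + (- 1) ^ Suc n * g (Suc n) s * ((s - y) ^ Suc n / fact (Suc n)))"
      by (rule ext) (simp only: F_def sum.atMost_Suc)
    have sign: "(- 1 :: real) ^ Suc n = - ((- 1) ^ n)" by simp
    have cancel: "c * u * t + (- c * v * w + t * (- c * u)) = - c * v * w" for c t u v w :: real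
      by simp
    show ?case unfolding F_Suc
    proof (rule DERIV_cong[OF step])
      show "(- 1) ^ n * g (Suc n) s * ((s - y) ^ n / fact n) +
          ((- 1) ^ Suc n * g (Suc (Suc n)) s * ((s - y) ^ Suc n / fact (Suc n))
           + (s - y) ^ n / fact n * ((- 1) ^ Suc n * g (Suc n) s))
        = (- 1) ^ Suc n * g (Suc (Suc n)) s * ((s - y) ^ Suc n / fact (Suc n))"
        unfolding sign by (rule cancel)
    qed
  qed
  have "((\<lambda>s. (- 1) ^ m * g (Suc m) s * ((s - y) ^ m / fact m)) has_integral (F m b - F m y)) {y..b}"
    using \<open>y \<le> b\<close> F
    by (intro fundamental_theorem_of_calculus) (auto simp: has_real_derivative_iff_has_vector_derivative)
  \<comment> \<open>At s = y only the term i = 0 survives, by the convention 0^0 = 1.\<close>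
  moreover have "F m y = g 0 y"
    unfolding F_def by (subst sum.atMost_shift) simp
  ultimately have "((\<lambda>s. (- 1) ^ m * ((- 1) ^ m * g (Suc m) s * ((s - y) ^ m / fact m))) has_integral
      (- 1) ^ m * (F m b - g 0 y)) {y..b}"
    by (intro has_integral_mult_right) simp
  moreover have "(- 1) ^ m * ((- 1) ^ m * u * v) = u * v" for u v :: real
    by (simp flip: mult.assoc power_mult_distrib)
  ultimately show ?thesis unfolding F_def by simp
qed

text \<open>Supplies test functions whose top derivative is a prescribed continuous
  function.\<close>

lemma iterated_antiderivative:
  fixes h :: "real \<Rightarrow> real"
  assumes "continuous_on {a..b} h"
  shows "\<exists>g. g n = h \<and> (\<forall>j\<le>n. continuous_on {a..b} (g j)) \<and>
    (\<forall>j<n. \<forall>x\<in>{a..b}. (g j has_real_derivative g (Suc j) x) (at x within {a..b}))"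
proof (induction n)
  case 0
  show ?case using assms by (intro exI[of _ "\<lambda>_. h"]) simp
next
  case (Suc n)
  then obtain g where g: "g n = h" "\<forall>j\<le>n. continuous_on {a..b} (g j)"
    "\<forall>j<n. \<forall>x\<in>{a..b}. (g j has_real_derivative g (Suc j) x) (at x within {a..b})"
    by blast
  \<comment> \<open>The new antiderivative enters at index 0 and shifts the old family up, so
    \<open>h\<close> stays on top.\<close>
  define G where "G = case_nat (\<lambda>x. integral {a..x} (g 0)) g"
  have "(G j has_real_derivative G (Suc j) x) (at x within {a..b})" if "j < Suc n" "x \<in> {a..b}" for j x
    using that g integral_has_real_derivative[of a b "g 0" x] by (auto simp: G_def split: nat.split)
  moreover from this have "continuous_on {a..b} (G 0)"
    by (meson DERIV_continuous_on zero_less_Suc)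
  then have "continuous_on {a..b} (G j)" if "j \<le> Suc n" for j
    using that g by (cases j) (auto simp: G_def)
  moreover have "G (Suc n) = h" using g by (simp add: G_def)
  ultimately show ?case by blast
qed

section \<open>Integration against truncated powers\<close>

text \<open>Fubini is applied to \<open>lebesgue\<close>, the completion of \<open>lborel\<close>,
  because \<open>P\<close> is only Lebesgue measurable. A countable cover by sets of finite measure
  remains one in the completion.\<close>

lemma sigma_finite_completion:
  assumes "sigma_finite_measure M"
  shows "sigma_finite_measure (completion M)"
proof -
  obtain A where "countable A" "A \<subseteq> sets M" "\<Union>A = space M" "\<forall>a\<in>A. emeasure M a \<noteq> \<infinity>"
    using sigma_finite_measure.sigma_finite_countable[OF assms] by blast
  then show ?thesis
    by (intro sigma_finite_measure.intro exI[of _ A]) (auto simp: subset_iff)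
qed

text \<open>The bounded kernel is dominated by \<open>C\<close> times the product of
  \<open>p\<close> and \<open>q\<close>, which is integrable on the product space.\<close>

lemma (in pair_sigma_finite) integrable_product_kernel:
  fixes p :: "_ \<Rightarrow> real" and q :: "_ \<Rightarrow> real" and k :: "_ \<Rightarrow> real"
  assumes p: "integrable M1 p" and q: "integrable M2 q"
    and k[measurable]: "k \<in> borel_measurable (M1 \<Otimes>\<^sub>M M2)" and "\<And>z. \<bar>k z\<bar> \<le> C"
  shows "integrable (M1 \<Otimes>\<^sub>M M2) (\<lambda>(x, y). p x * q y * k (x, y))"
proof -
  note [measurable] = borel_measurable_integrable[OF p] borel_measurable_integrable[OF q]
  have "integrable (M1 \<Otimes>\<^sub>M M2) (\<lambda>z. p (fst z) * q (snd z))"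
    using p q by (intro Fubini_integrable) (auto simp: abs_mult)
  then have "integrable (M1 \<Otimes>\<^sub>M M2) (\<lambda>z. C * (p (fst z) * q (snd z)))" by simp
  moreover have "(\<lambda>z. p (fst z) * q (snd z) * k z) \<in> borel_measurable (M1 \<Otimes>\<^sub>M M2)"
    by measurable
  moreover have "norm (p (fst z) * q (snd z) * k z) \<le> norm (C * (p (fst z) * q (snd z)))" for z
  proof -
    have "\<bar>p (fst z) * q (snd z)\<bar> * \<bar>k z\<bar> \<le> \<bar>p (fst z) * q (snd z)\<bar> * \<bar>C\<bar>"
      using assms(4)[of z] by (intro mult_left_mono) auto
    then show ?thesis by (simp add: abs_mult mult.commute mult.left_commute)
  qed
  ultimately have "integrable (M1 \<Otimes>\<^sub>M M2) (\<lambda>z. p (fst z) * q (snd z) * k z)"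
    by (rule Bochner_Integration.integrable_bound[OF _ _ AE_I2])
  then show ?thesis by (simp add: case_prod_unfold)
qed

text \<open>With z = (y, s) this is the truncated power (s-y)_+^m / m!, cut off to the triangle a
  \<le> y \<le> s \<le> b. The cutoff makes it bounded and lets one kernel encode the limits of both
  iterated integrals.\<close>

definition truncated_power_kernel :: "real \<Rightarrow> real \<Rightarrow> nat \<Rightarrow> real \<times> real \<Rightarrow> real" where
  "truncated_power_kernel a b m z =
     (if a \<le> fst z \<and> fst z \<le> snd z \<and> snd z \<le> b then (snd z - fst z) ^ m / fact m else 0)"

lemma borel_measurable_lebesgue_fst_snd [measurable]:
  "fst \<in> borel_measurable ((lebesgue :: real measure) \<Otimes>\<^sub>M (lebesgue :: real measure))"
  "snd \<in> borel_measurable ((lebesgue :: real measure) \<Otimes>\<^sub>M (lebesgue :: real measure))"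
proof -
  have id: "(\<lambda>x. x) \<in> borel_measurable (lebesgue :: real measure)"
    by (rule measurable_completion) simp
  show "fst \<in> borel_measurable ((lebesgue :: real measure) \<Otimes>\<^sub>M (lebesgue :: real measure))"
    by (rule measurable_compose[OF measurable_fst id])
  show "snd \<in> borel_measurable ((lebesgue :: real measure) \<Otimes>\<^sub>M (lebesgue :: real measure))"
    by (rule measurable_compose[OF measurable_snd id])
qed

lemma truncated_power_kernel_measurable:
  "truncated_power_kernel a b m \<in> borel_measurable (lebesgue \<Otimes>\<^sub>M lebesgue)"
  unfolding truncated_power_kernel_def[abs_def] by measurable

lemma abs_truncated_power_kernel_le:
  "\<bar>truncated_power_kernel a b m z\<bar> \<le> \<bar>b - a\<bar> ^ m / fact m"
  by (auto simp: truncated_power_kernel_def abs_mult power_abs intro!: divide_right_mono power_mono)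

lemma pair_sigma_finite_lebesgue:
  "pair_sigma_finite (lebesgue :: real measure) (lebesgue :: real measure)"
  by (intro pair_sigma_finite.intro sigma_finite_completion sigma_finite_lborel)

lemma set_integral_truncated_power:
  fixes P :: "real \<Rightarrow> real"
  assumes "s \<in> {a..b}"
  shows "(LINT y:{a..s}|lebesgue. P y * ((s - y) ^ m / fact m)) =
    (LINT y|lebesgue. indicator {a..b} y *\<^sub>R P y * truncated_power_kernel a b m (y, s))"
  unfolding set_lebesgue_integral_def using assms
  by (intro Bochner_Integration.integral_cong refl)
     (auto simp: truncated_power_kernel_def indicator_def)

lemma integrable_moment:
  fixes P :: "real \<Rightarrow> real" and c :: real
  assumes "set_integrable lebesgue {a..b} P"
  shows "integrable lebesgue (\<lambda>y. indicator {a..b} y *\<^sub>R P y * (c * ((b - y) ^ i / fact i)))"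
proof -
  have "bounded ((\<lambda>y. c * ((b - y) ^ i / fact i)) ` {a..b})"
    by (intro compact_imp_bounded compact_continuous_image continuous_intros compact_Icc) simp
  then obtain B where B: "\<And>y. y \<in> {a..b} \<Longrightarrow> norm (c * ((b - y) ^ i / fact i)) \<le> B"
    unfolding bounded_iff by blast
  have p: "integrable lebesgue (\<lambda>y. indicator {a..b} y *\<^sub>R P y)"
    using assms by (simp add: set_integrable_def)
  have [measurable]: "(\<lambda>y. c * ((b - y) ^ i / fact i)) \<in> borel_measurable lebesgue"
    by (rule measurable_completion) measurable
  show ?thesis
  proof (rule Bochner_Integration.integrable_bound)
    show "integrable lebesgue (\<lambda>y. B * (indicator {a..b} y *\<^sub>R P y))" using p by simp
    show "AE y in lebesgue. norm (indicator {a..b} y *\<^sub>R P y * (c * ((b - y) ^ i / fact i)))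
        \<le> norm (B * (indicator {a..b} y *\<^sub>R P y))"
    proof (rule AE_I2)
      fix y
      show "norm (indicator {a..b} y *\<^sub>R P y * (c * ((b - y) ^ i / fact i)))
        \<le> norm (B * (indicator {a..b} y *\<^sub>R P y))"
      proof (cases "y \<in> {a..b}")
        case True
        have "\<bar>P y\<bar> * \<bar>c * ((b - y) ^ i / fact i)\<bar> \<le> \<bar>P y\<bar> * \<bar>B\<bar>"
          using B[OF True] by (intro mult_left_mono) auto
        then show ?thesis using True by (simp add: abs_mult mult.commute)
      qed simp
    qed
  qed (use borel_measurable_integrable[OF p] in measurable)
qed

text \<open>Taylor's formula at \<open>b\<close> is multiplied by \<open>P\<close> and integrated;
  exchanging the order of integration over the triangle turns the remainder into an integral against
  the truncated moments of \<open>P\<close>.\<close>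

lemma set_integral_Taylor_right:
  fixes g :: "nat \<Rightarrow> real \<Rightarrow> real" and P :: "real \<Rightarrow> real"
  assumes P: "set_integrable lebesgue {a..b} P"
    and deriv: "\<And>j x. j \<le> m \<Longrightarrow> x \<in> {a..b} \<Longrightarrow>
      (g j has_real_derivative g (Suc j) x) (at x within {a..b})"
    and cont: "continuous_on {a..b} (g (Suc m))"
  shows "(LINT y:{a..b}|lebesgue. g 0 y * P y) =
    (\<Sum>i\<le>m. (- 1) ^ i * g i b * (LINT y:{a..b}|lebesgue. P y * ((b - y) ^ i / fact i)))
    + (LINT s:{a..b}|lebesgue. (- 1) ^ Suc m * g (Suc m) s *
        (LINT y:{a..s}|lebesgue. P y * ((s - y) ^ m / fact m)))"
proof -
  interpret pair_sigma_finite "lebesgue :: real measure" "lebesgue :: real measure"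
    by (rule pair_sigma_finite_lebesgue)
  \<comment> \<open>Extension by zero turns the set integrals into integrals over the whole line,
    with all limits carried by \<open>p\<close>, \<open>q\<close> and \<open>k\<close>.\<close>
  define p where "p y = indicator {a..b} y *\<^sub>R P y" for y
  define q where "q s = indicator {a..b} s *\<^sub>R ((- 1) ^ Suc m * g (Suc m) s)" for s
  define k where "k = truncated_power_kernel a b m"
  have p: "integrable lebesgue p" using P by (simp add: p_def[abs_def] set_integrable_def)
  have "(\<lambda>s. (- 1) ^ Suc m * g (Suc m) s) absolutely_integrable_on {a..b}"
    by (intro absolutely_integrable_continuous_real continuous_intros cont)
  then have q: "integrable lebesgue q" by (simp add: q_def[abs_def] set_integrable_def)
  have int: "integrable (lebesgue \<Otimes>\<^sub>M lebesgue) (\<lambda>(y, s). p y * q s * k (y, s))"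
    unfolding k_def
    by (rule integrable_product_kernel[OF p q truncated_power_kernel_measurable abs_truncated_power_kernel_le])
  have Taylor: "p y * g 0 y = (\<Sum>i\<le>m. p y * ((- 1) ^ i * g i b * ((b - y) ^ i / fact i)))
      + (LINT s|lebesgue. p y * q s * k (y, s))" for y
  proof (cases "y \<in> {a..b}")
    case True
    then have sub: "{y..b} \<subseteq> {a..b}" and "y \<le> b" by auto
    let ?G = "\<lambda>s. g (Suc m) s * ((s - y) ^ m / fact m)"
    define T where "T = (\<Sum>i\<le>m. (- 1) ^ i * g i b * ((b - y) ^ i / fact i))"
    have "?G absolutely_integrable_on {y..b}"
      by (intro absolutely_integrable_continuous_real continuous_intros continuous_on_subset[OF cont sub]) simp
    then have "(LINT s:{y..b}|lebesgue. ?G s) = integral {y..b} ?G"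
      by (rule set_lebesgue_integral_eq_integral)
    also have "\<dots> = (- 1) ^ m * (T - g 0 y)"
      unfolding T_def
    proof (intro integral_unique Taylor_remainder_has_integral_right \<open>y \<le> b\<close>)
      show "(g j has_real_derivative g (Suc j) x) (at x within {y..b})" if "j \<le> m" "x \<in> {y..b}" for j x
        using deriv that sub by (blast intro: DERIV_subset)
    qed
    finally have remainder: "(- 1) ^ m * (LINT s:{y..b}|lebesgue. ?G s) = T - g 0 y"
      by (simp flip: mult.assoc power_mult_distrib)
    \<comment> \<open>\<open>q\<close> carries the sign (-1)^(m+1) = -(-1)^m, which turns
      \<open>T - g 0 y\<close> into \<open>g 0 y - T\<close>.\<close>
    have "(LINT s|lebesgue. p y * q s * k (y, s)) =
        (LINT s|lebesgue. p y * (- ((- 1) ^ m)) * (indicator {y..b} s *\<^sub>R ?G s))"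
      using True by (intro Bochner_Integration.integral_cong refl)
        (auto simp: q_def k_def truncated_power_kernel_def indicator_def)
    also have "\<dots> = p y * (- ((- 1) ^ m)) * (LINT s:{y..b}|lebesgue. ?G s)"
      unfolding set_lebesgue_integral_def by (simp only: integral_mult_right_zero)
    also have "\<dots> = p y * (g 0 y - T)"
      using remainder by (simp only: mult.assoc mult_minus_left minus_diff_eq flip: mult_minus_right)
    finally show ?thesis
      by (simp only: T_def[symmetric] right_diff_distrib flip: sum_distrib_left)
  next
    case False
    then have "p y = 0" by (simp add: p_def)
    then show ?thesis by simp
  qed
  have "(LINT y:{a..b}|lebesgue. g 0 y * P y) = (LINT y|lebesgue. p y * g 0 y)"
    by (simp add: set_lebesgue_integral_def p_def mult_ac)
  also have "\<dots> = (\<Sum>i\<le>m. LINT y|lebesgue. p y * ((- 1) ^ i * g i b * ((b - y) ^ i / fact i)))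
      + (LINT y|lebesgue. LINT s|lebesgue. p y * q s * k (y, s))"
    unfolding Taylor using integrable_moment[OF P] integrable_fst[OF int]
    by (simp add: Bochner_Integration.integral_add Bochner_Integration.integral_sum p_def)
  also have "(\<lambda>i. LINT y|lebesgue. p y * ((- 1) ^ i * g i b * ((b - y) ^ i / fact i))) =
      (\<lambda>i. (- 1) ^ i * g i b * (LINT y:{a..b}|lebesgue. P y * ((b - y) ^ i / fact i)))"
    unfolding set_lebesgue_integral_def p_def
    by (simp add: mult_ac flip: integral_mult_right_zero)
  also have "(LINT y|lebesgue. LINT s|lebesgue. p y * q s * k (y, s)) =
      (LINT s|lebesgue. LINT y|lebesgue. p y * q s * k (y, s))"
    by (rule Fubini_integral[OF int, symmetric])
  also have "\<dots> = (LINT s:{a..b}|lebesgue. (- 1) ^ Suc m * g (Suc m) s *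
        (LINT y:{a..s}|lebesgue. P y * ((s - y) ^ m / fact m)))"
    unfolding set_lebesgue_integral_def[of _ "{a..b}"]
  proof (intro Bochner_Integration.integral_cong refl)
    fix s
    have "(LINT y|lebesgue. p y * q s * k (y, s)) = q s * (LINT y|lebesgue. p y * k (y, s))"
      by (simp add: mult_ac flip: integral_mult_right_zero)
    then show "(LINT y|lebesgue. p y * q s * k (y, s)) = indicator {a..b} s *\<^sub>R
        ((- 1) ^ Suc m * g (Suc m) s * (LINT y:{a..s}|lebesgue. P y * ((s - y) ^ m / fact m)))"
      using set_integral_truncated_power[of s a b P m]
      by (cases "s \<in> {a..b}") (simp_all add: p_def k_def q_def)
  qed
  finally show ?thesis .
qed

text \<open>Dominated convergence along sequences, with the uniform kernel bound times |p| as
  majorant.\<close>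

lemma continuous_on_truncated_power_integral:
  fixes P :: "real \<Rightarrow> real"
  assumes "set_integrable lebesgue {a..b} P"
  shows "continuous_on {a..b} (\<lambda>s. LINT y:{a..s}|lebesgue. P y * ((s - y) ^ m / fact m))"
proof -
  define p where "p y = indicator {a..b} y *\<^sub>R P y" for y
  define k where "k = truncated_power_kernel a b m"
  have p: "integrable lebesgue p" using assms by (simp add: p_def[abs_def] set_integrable_def)
  have km [measurable]: "(\<lambda>y. k (y, s)) \<in> borel_measurable lebesgue" for s
    unfolding k_def
    by (rule measurable_compose[OF _ truncated_power_kernel_measurable]) simp
  have pm [measurable]: "p \<in> borel_measurable lebesgue" using p by simp
  have "continuous_on {a..b} (\<lambda>s. LINT y|lebesgue. p y * k (y, s))"
    unfolding continuous_on_sequentially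
  proof (intro ballI allI impI, elim conjE, unfold comp_def)
    fix S :: "nat \<Rightarrow> real" and s
    assume s: "s \<in> {a..b}" and S: "\<forall>n. S n \<in> {a..b}" and lim: "S \<longlonglongrightarrow> s"
    show "(\<lambda>n. LINT y|lebesgue. p y * k (y, S n)) \<longlonglongrightarrow> (LINT y|lebesgue. p y * k (y, s))"
    proof (rule integral_dominated_convergence)
      show "integrable lebesgue (\<lambda>y. \<bar>b - a\<bar> ^ m / fact m * norm (p y))" using p by simp
      show "AE y in lebesgue. norm (p y * k (y, S n)) \<le> \<bar>b - a\<bar> ^ m / fact m * norm (p y)" for n
        using mult_right_mono[OF abs_truncated_power_kernel_le abs_ge_zero]
        by (intro AE_I2) (simp add: k_def abs_mult mult.commute)
      \<comment> \<open>For m = 0 the kernel jumps at y = s, so pointwise convergence is claimed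
        only off this null set.\<close>
      have "AE y in lebesgue. y \<noteq> s" by (intro AE_completion AE_lborel_singleton)
      then show "AE y in lebesgue. (\<lambda>n. p y * k (y, S n)) \<longlonglongrightarrow> p y * k (y, s)"
      proof eventually_elim
        case (elim y)
        have "(\<lambda>n. k (y, S n)) \<longlonglongrightarrow> k (y, s)" if y: "y \<in> {a..b}"
        proof (cases "y < s")
          case True
          have "\<forall>\<^sub>F n in sequentially. k (y, S n) = (S n - y) ^ m / fact m"
            using order_tendstoD(1)[OF lim True]
            by eventually_elim (use S y in \<open>auto simp: k_def truncated_power_kernel_def\<close>)
          moreover have "(\<lambda>n. (S n - y) ^ m / fact m) \<longlonglongrightarrow> k (y, s)"
            using True y s lim by (auto simp: k_def truncated_power_kernel_def intro!: tendsto_intros)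
          ultimately show ?thesis by (simp add: tendsto_cong)
        next
          case False
          then have "s < y" using elim by simp
          have "\<forall>\<^sub>F n in sequentially. k (y, S n) = 0"
            using order_tendstoD(2)[OF lim \<open>s < y\<close>]
            by eventually_elim (auto simp: k_def truncated_power_kernel_def)
          then show ?thesis using \<open>s < y\<close>
            by (auto simp: k_def truncated_power_kernel_def intro: tendsto_eventually)
        qed
        then show ?case by (cases "y \<in> {a..b}") (auto simp: p_def intro!: tendsto_intros)
      qed
    qed auto
  qed
  then show ?thesis
    by (rule continuous_on_eq) (simp only: set_integral_truncated_power p_def k_def)
qed

section \<open>Necessity and sufficiency of the moment conditions\<close>

lemma C_k_onI:
  assumes "\<And>j x. j < k \<Longrightarrow> x \<in> I \<Longrightarrow> (g j has_real_derivative g (Suc j) x) (at x within I)"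
    and "continuous_on I (g k)"
  shows "C_k_on k I (g 0)"
  unfolding C_k_on_def
proof (intro exI[of _ g] conjI allI impI ballI)
  fix j assume "j \<le> k"
  then show "continuous_on I (g j)"
    using assms by (cases "j = k") (auto intro!: DERIV_continuous_on[of I "g j" "g (Suc j)"])
qed (use assms in auto)

lemma moment_eq_0:
  fixes P :: "real \<Rightarrow> real"
  assumes nonneg: "\<And>f. nabla_convex_on (Suc m) {a..b} f \<Longrightarrow> C_k_on (Suc m) {a..b} f \<Longrightarrow>
      (LINT y:{a..b}|lebesgue. f y * P y) \<ge> 0"
    and "i \<le> m"
  shows "(LINT y:{a..b}|lebesgue. P y * ((b - y) ^ i / fact i)) = 0"
proof -
  \<comment> \<open>The test function c (b-y)^i / i! has degree at most m, so its derivative of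
    order m+1 vanishes and it is admissible for either sign of \<open>c\<close>.\<close>
  have *: "(LINT y:{a..b}|lebesgue. c * (P y * ((b - y) ^ i / fact i))) \<ge> 0" for c :: real
  proof -
    define p where "p = smult (c / fact i) ([:b, -1:] ^ i)"
    define g where "g j = poly ((pderiv ^^ j) p)" for j
    have "degree p \<le> i"
      unfolding p_def by (intro order.trans[OF degree_smult_le] order.trans[OF degree_power_le]) simp
    then have "degree ((pderiv ^^ m) p) = 0"
      using \<open>i \<le> m\<close> by (simp add: degree_pderiv_funpow)
    then have top: "g (Suc m) = (\<lambda>_. 0)"
      by (simp add: g_def fun_eq_iff pderiv_eq_0_iff[THEN iffD2])
    have deriv: "(g j has_real_derivative g (Suc j) x) (at x within {a..b})" for j x
      unfolding g_def by (auto intro!: DERIV_subset[OF poly_DERIV])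
    have "nabla_convex_on (Suc m) {a..b} (g 0)"
      by (rule nabla_convex_on_if_deriv_nonneg) (use deriv top in auto)
    moreover have "C_k_on (Suc m) {a..b} (g 0)"
      by (rule C_k_onI) (use deriv top in auto)
    ultimately have "(LINT y:{a..b}|lebesgue. g 0 y * P y) \<ge> 0" by (rule nonneg)
    then show ?thesis by (simp add: g_def p_def mult_ac)
  qed
  from *[of 1] *[of "- 1"] show ?thesis by (simp add: set_lebesgue_integral_def)
qed

lemma truncated_power_integral_nonneg:
  fixes P :: "real \<Rightarrow> real"
  assumes "a < b" and P: "set_integrable lebesgue {a..b} P"
    and nonneg: "\<And>f. nabla_convex_on (Suc m) {a..b} f \<Longrightarrow> C_k_on (Suc m) {a..b} f \<Longrightarrow>
      (LINT y:{a..b}|lebesgue. f y * P y) \<ge> 0"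
    and s: "s \<in> {a..b}"
  shows "(LINT y:{a..s}|lebesgue. P y * ((s - y) ^ m / fact m)) \<ge> 0"
proof (rule ccontr)
  define Q where "Q s = (LINT y:{a..s}|lebesgue. P y * ((s - y) ^ m / fact m))" for s
  assume "\<not> ?thesis"
  then have "Q s < 0" by (simp add: Q_def)
  have Q: "continuous_on {a..b} Q"
    unfolding Q_def[abs_def] by (rule continuous_on_truncated_power_integral[OF P])
  obtain c d where "c < d" and sub: "{c..d} \<subseteq> {a..b}" and neg: "\<And>t. t \<in> {c..d} \<Longrightarrow> Q t < 0"
    using continuous_on_neg_subinterval[OF \<open>a < b\<close> Q s \<open>Q s < 0\<close>] by blast
  \<comment> \<open>A continuous bump, positive exactly on the open interval (c, d).\<close>
  define h where "h t = max 0 ((t - c) * (d - t))" for t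
  have h0: "h t = 0" if "t \<notin> {c..d}" for t
    using that \<open>c < d\<close> by (auto simp: h_def max_def zero_le_mult_iff)
  have h: "continuous_on {a..b} h" unfolding h_def[abs_def] by (intro continuous_intros)
  have "continuous_on {a..b} (\<lambda>t. (- 1) ^ Suc m * h t)" by (intro continuous_intros h)
  from iterated_antiderivative[OF this, of "Suc m"] obtain g
    where top: "g (Suc m) = (\<lambda>t. (- 1) ^ Suc m * h t)"
      and deriv: "\<And>j x. j < Suc m \<Longrightarrow> x \<in> {a..b} \<Longrightarrow>
        (g j has_real_derivative g (Suc j) x) (at x within {a..b})"
      and cont: "continuous_on {a..b} (g (Suc m))"
    by blast
  have sign: "(- 1) ^ Suc m * g (Suc m) t = h t" for t
    unfolding top by (simp only: flip: mult.assoc power_mult_distrib) simp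
  have "nabla_convex_on (Suc m) {a..b} (g 0)"
  proof (rule nabla_convex_on_if_deriv_nonneg)
    show "0 \<le> (- 1) ^ Suc m * g (Suc m) t" for t unfolding sign by (simp add: h_def)
  qed (rule deriv)
  moreover have "C_k_on (Suc m) {a..b} (g 0)" by (rule C_k_onI[of _ _ g, OF deriv cont])
  ultimately have "0 \<le> (LINT y:{a..b}|lebesgue. g 0 y * P y)" by (rule nonneg)
  also have "\<dots> = (\<Sum>i\<le>m. (- 1) ^ i * g i b * (LINT y:{a..b}|lebesgue. P y * ((b - y) ^ i / fact i)))
    + (LINT s:{a..b}|lebesgue. (- 1) ^ Suc m * g (Suc m) s * Q s)"
    unfolding Q_def by (rule set_integral_Taylor_right[of a b P m g, OF P _ cont]) (use deriv in auto)
  \<comment> \<open>The moments vanish by the previous lemma, so only the integral of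
    \<open>h t * Q t\<close> is left. It is nonnegative by assumption and nonpositive by the choice
    of \<open>h\<close>.\<close>
  also have "(\<Sum>i\<le>m. (- 1) ^ i * g i b * (LINT y:{a..b}|lebesgue. P y * ((b - y) ^ i / fact i))) = 0"
    using moment_eq_0[OF nonneg] by (intro sum.neutral) simp
  finally have "0 \<le> (LINT t:{a..b}|lebesgue. h t * Q t)" by (simp only: sign add_0)
  moreover have hQ: "continuous_on {a..b} (\<lambda>t. h t * Q t)" by (intro continuous_intros h Q)
  then have int: "(\<lambda>t. h t * Q t) absolutely_integrable_on {a..b}"
    by (rule absolutely_integrable_continuous_real)
  ultimately have "0 \<le> integral {a..b} (\<lambda>t. h t * Q t)"
    by (simp add: set_lebesgue_integral_eq_integral(2))
  moreover have le: "h t * Q t \<le> 0" for t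
  proof (cases "t \<in> {c..d}")
    case True
    then show ?thesis using neg[OF True] by (intro mult_nonneg_nonpos) (auto simp: h_def)
  qed (simp add: h0)
  have "integral {a..b} (\<lambda>t. h t * Q t) \<le> 0"
    using integral_le[OF integrable_continuous_real[OF hQ] integrable_0] le by simp
  ultimately have "integral {a..b} (\<lambda>t. h t * Q t) = 0" by simp
  then have "((\<lambda>t. - (h t * Q t)) has_integral 0) {a..b}"
    using has_integral_neg[OF integrable_integral[OF integrable_continuous_real[OF hQ]]] by simp
  \<comment> \<open>A continuous function of constant sign with zero integral vanishes everywhere,
    which fails at the midpoint of the bump.\<close>
  then have zero: "- (h t * Q t) = 0" if "t \<in> {a..b}" for t
    using has_integral_0_cbox_imp_0[of a b "\<lambda>t. - (h t * Q t)" t] that le hQ \<open>a < b\<close>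
    by (simp add: continuous_on_minus)
  define e where "e = (c + d) / 2"
  have "e \<in> {c..d}" "h e > 0"
    using \<open>c < d\<close> by (auto simp: e_def h_def less_max_iff_disj intro!: mult_pos_pos)
  then show False using zero[of e] neg[of e] sub by auto
qed

theorem theorem2p4:
  fixes a b :: real and m :: nat and P :: "real \<Rightarrow> real"
  assumes "a < b"
    and "set_integrable lebesgue {a..b} P"
  shows "(\<forall>f :: real \<Rightarrow> real. nabla_convex_on (m + 1) {a..b} f \<and> C_k_on (m + 1) {a..b} f
            \<longrightarrow> (LINT y:{a..b}|lebesgue. f y * P y) \<ge> 0)
     \<longleftrightarrow>
         (\<forall>i\<in>{0..m}. (LINT y:{a..b}|lebesgue. P y * ((b - y) ^ i / fact i)) = 0)
       \<and> (\<forall>s\<in>{a..b}. (LINT y:{a..s}|lebesgue. P y * ((s - y) ^ m / fact m)) \<ge> 0)"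
    (is "?L \<longleftrightarrow> ?M \<and> ?T")
proof (intro iffI conjI)
  assume ?L
  then have nonneg: "\<And>f. nabla_convex_on (Suc m) {a..b} f \<Longrightarrow> C_k_on (Suc m) {a..b} f \<Longrightarrow>
      (LINT y:{a..b}|lebesgue. f y * P y) \<ge> 0"
    by simp
  show ?M using moment_eq_0[OF nonneg] by simp
  show ?T using truncated_power_integral_nonneg[OF assms nonneg] by blast
next
  assume MT: "?M \<and> ?T"
  show ?L
  proof (intro allI impI, elim conjE)
    fix f assume conv: "nabla_convex_on (m + 1) {a..b} f" and "C_k_on (m + 1) {a..b} f"
    then obtain g where g: "g 0 = f"
      and deriv: "\<And>j x. j < Suc m \<Longrightarrow> x \<in> {a..b} \<Longrightarrow>
        (g j has_real_derivative g (Suc j) x) (at x within {a..b})"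
      and cont: "continuous_on {a..b} (g (Suc m))"
      unfolding C_k_on_def by (metis Suc_eq_plus1 order_refl)
    have pos: "(- 1) ^ Suc m * g (Suc m) s \<ge> 0" if "s \<in> {a..b}" for s
      using deriv_nonneg_if_nabla_convex_on[of a b "Suc m" g s] \<open>a < b\<close> conv g deriv cont that by simp
    have "(LINT y:{a..b}|lebesgue. f y * P y) =
      (\<Sum>i\<le>m. (- 1) ^ i * g i b * (LINT y:{a..b}|lebesgue. P y * ((b - y) ^ i / fact i)))
      + (LINT s:{a..b}|lebesgue. (- 1) ^ Suc m * g (Suc m) s *
          (LINT y:{a..s}|lebesgue. P y * ((s - y) ^ m / fact m)))"
      unfolding g[symmetric] by (rule set_integral_Taylor_right[of a b P m g, OF assms(2) _ cont]) (use deriv in auto)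
    also have "\<dots> = (LINT s:{a..b}|lebesgue. (- 1) ^ Suc m * g (Suc m) s *
          (LINT y:{a..s}|lebesgue. P y * ((s - y) ^ m / fact m)))"
      using MT by simp
    \<comment> \<open>On [a, b] the integrand is a product of two nonnegative factors, one from
      convexity (\<open>pos\<close>) and one from \<open>?T\<close>.\<close>
    also have "\<dots> \<ge> 0"
      unfolding set_lebesgue_integral_def[of _ "{a..b}"]
    proof (intro Bochner_Integration.integral_nonneg)
      fix s
      show "0 \<le> indicator {a..b} s *\<^sub>R ((- 1) ^ Suc m * g (Suc m) s *
          (LINT y:{a..s}|lebesgue. P y * ((s - y) ^ m / fact m)))"
        using MT pos[of s] by (cases "s \<in> {a..b}") (simp_all only: indicator_simps scaleR_one
          scaleR_zero_left order_refl not_False_eq_True mult_nonneg_nonneg)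
    qed
    finally show "(LINT y:{a..b}|lebesgue. f y * P y) \<ge> 0" .
  qed
qed

end
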